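(* Let $(X,d)$ be a complete metric space and let $A,B$ be non-empty closed subsets of $X$ with $|A_0|\geq 3$, such that $A$ is approximatively compact with respect to $B$. Let $T:A\to B$ be a continuous perimetric proximal contraction of the second kind such that $T(A_0)\subseteq B_0$. If $T$ satisfies Condition $\Lambda$, then $T$ possesses a best proximity point. Further, if in addition $T$ is injective, then $T$ has at most two best proximity points.
   Context: For non-empty subsets $A,B$ of a metric space $(X,d)$, put $d(A,B)=\inf\{d(a,b): a\in A,\ b\in B\}$, $A_0=\{x\in A: d(x,y)=d(A,B)\text{ for some } y\in B\}$, and $B_0=\{y\in B: d(x,y)=d(A,B)\text{ for some } x\in A\}$. For $u\in X$, $d(u,A)=\inf\{d(u,a):a\in A\}$. A best proximity point of a mapping $T:A\to B$ is a point $x^*\in A$ such that $d(x^*,Tx^* )=d(A,B)$. A mapping $T:A\to B$ is a perimetric proximal contraction of the second kind if there exists $\alpha\in[0,1)$ such that for all $u_1,u_2,u_3,x_1,x_2,x_3\in A$ with $Tx_1,Tx_2,Tx_3$ pairwise distinct, the equalities $d(u_1,Tx_1)=d(u_2,Tx_2)=d(u_3,Tx_3)=d(A,B)$ imply $$d(Tu_1,Tu_2)+d(Tu_2,Tu_3)+d(Tu_3,Tu_1)\leq \alpha\{d(Tx_1,Tx_2)+d(Tx_2,Tx_3)+d(Tx_3,Tx_1)\}.$$ A mapping $T:A\to B$ satisfies Condition $\Lambda$ if there is no pair of points $x,y\in A$ with $x\neq y$ such that $d(x,Ty)=d(y,Tx)=d(A,B)$. $A$ is approximatively compact with respect to $B$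 if every sequence $\{u_n\}$ in $A$ satisfying $d(u,u_n)\to d(u,A)$ for some $u\in B$ has a convergent subsequence. *)

theory Defs
  imports "HOL-Analysis.Analysis"
begin

definition prox_left :: "'a::metric_space set \<Rightarrow> 'a set \<Rightarrow> 'a set" where
  "prox_left A B = {x \<in> A. \<exists>y\<in>B. dist x y = setdist A B}"

definition prox_right :: "'a::metric_space set \<Rightarrow> 'a set \<Rightarrow> 'a set" where
  "prox_right A B = {y \<in> B. \<exists>x\<in>A. dist x y = setdist A B}"

(* Mappings T : A -> B are total functions on the ambient type; only their values on A are
   used below, and T \<in> A \<rightarrow> B is stated as a separate hypothesis. *)

definition best_proximity_point ::
    "'a::metric_space set \<Rightarrow> 'a set \<Rightarrow> ('a \<Rightarrow> 'a) \<Rightarrow> 'a \<Rightarrow> bool" where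
  "best_proximity_point A B T x \<longleftrightarrow> x \<in> A \<and> dist x (T x) = setdist A B"

definition perimetric_proximal_contraction_2 ::
    "'a::metric_space set \<Rightarrow> 'a set \<Rightarrow> ('a \<Rightarrow> 'a) \<Rightarrow> bool" where
  "perimetric_proximal_contraction_2 A B T \<longleftrightarrow>
    (\<exists>\<alpha>::real. 0 \<le> \<alpha> \<and> \<alpha> < 1 \<and>
      (\<forall>u1\<in>A. \<forall>u2\<in>A. \<forall>u3\<in>A. \<forall>x1\<in>A. \<forall>x2\<in>A. \<forall>x3\<in>A.
        T x1 \<noteq> T x2 \<longrightarrow> T x2 \<noteq> T x3 \<longrightarrow> T x3 \<noteq> T x1 \<longrightarrow>
        dist u1 (T x1) = setdist A B \<longrightarrow>
        dist u2 (T x2) = setdist A B \<longrightarrow>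
        dist u3 (T x3) = setdist A B \<longrightarrow>
        dist (T u1) (T u2) + dist (T u2) (T u3) + dist (T u3) (T u1)
          \<le> \<alpha> * (dist (T x1) (T x2) + dist (T x2) (T x3) + dist (T x3) (T x1))))"

definition condition_Lambda ::
    "'a::metric_space set \<Rightarrow> 'a set \<Rightarrow> ('a \<Rightarrow> 'a) \<Rightarrow> bool" where
  "condition_Lambda A B T \<longleftrightarrow>
    \<not> (\<exists>x\<in>A. \<exists>y\<in>A. x \<noteq> y \<and> dist x (T y) = setdist A B \<and> dist y (T x) = setdist A B)"

(* Convergence is in the ambient space; for closed A the limit automatically lies in A. *)
definition approximatively_compact_wrt :: "'a::metric_space set \<Rightarrow> 'a set \<Rightarrow> bool" where
  "approximatively_compact_wrt A B \<longleftrightarrow>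
    (\<forall>s::nat \<Rightarrow> 'a. (\<forall>n. s n \<in> A) \<longrightarrow>
      (\<exists>u\<in>B. (\<lambda>n. dist u (s n)) \<longlonglongrightarrow> infdist u A) \<longrightarrow>
      (\<exists>r::nat \<Rightarrow> nat. strict_mono r \<and> convergent (s \<circ> r)))"

end

theory Submission
  imports Defs
begin

text \<open>
  The contraction controls images of triples under one proximal step \<open>x \<mapsto> u\<close>,
  \<open>d(u, T x) = d(A, B)\<close>, so the argument follows a proximal orbit: points \<open>x n \<in> A\<close> with
  \<open>d(x (n + 1), T (x n)) = d(A, B)\<close>, which exist because \<open>T\<close> sends \<open>A\<^sub>0\<close> into \<open>B\<^sub>0\<close>.
  As long as no orbit point is a best proximity point, three consecutive images are pairwise
  distinct: equality of neighbours makes an orbit point a best proximity point at once, and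
  Condition \<open>\<Lambda>\<close> makes equality at distance two do the same
  (\<open>proximal_orbit_images_distinct\<close>). Hence the perimeters of the triangles of three
  consecutive images decay geometrically, and the images converge to some \<open>y \<in> B\<close>. The orbit
  itself is asymptotically nearest to \<open>y\<close>, so approximative compactness supplies a
  subsequential limit \<open>x \<in> A\<close> of it, and continuity yields \<open>T x = y\<close> and
  \<open>d(x, T x) = d(A, B)\<close> (\<open>proximal_orbit_limit\<close>).

  For the bound on their number: a best proximity point is a proximal step of itself, so for
  three of them with distinct images the contraction would make a positive perimeter strictly
  smaller than itself.
\<close>

lemma Cauchy_if_geometric_steps:
  fixes y :: "nat \<Rightarrow> 'a::metric_space"
  assumes "0 \<le> \<alpha>" "\<alpha> < 1" and step: "\<And>n. dist (y n) (y (Suc n)) \<le> C * \<alpha> ^ n"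
  shows "Cauchy y"
proof (rule metric_CauchyI)
  fix e :: real assume "0 < e"
  have sm: "summable (\<lambda>n. C * \<alpha> ^ n)"
    using assms(1,2) by (intro summable_mult summable_geometric) auto
  obtain N where N: "\<And>m n. m \<ge> N \<Longrightarrow> norm (\<Sum>i\<in>{m..<n}. C * \<alpha> ^ i) < e"
    using sm \<open>0 < e\<close> unfolding summable_Cauchy by blast
  have tail: "dist (y m) (y (m + k)) \<le> (\<Sum>i\<in>{m..<m + k}. C * \<alpha> ^ i)" for m k
  proof (induction k)
    case (Suc k)
    have "dist (y m) (y (m + Suc k)) \<le> dist (y m) (y (m + k)) + dist (y (m + k)) (y (Suc (m + k)))"
      by (simp add: dist_triangle)
    with Suc step[of "m + k"] show ?case by simp
  qed simp
  have less: "dist (y m) (y n) < e" if "N \<le> m" "m \<le> n" for m n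
    using tail[of m "n - m"] N[OF that(1), of n] that(2) by simp
  show "\<exists>M. \<forall>m\<ge>M. \<forall>n\<ge>M. dist (y m) (y n) < e"
    using less by (metis dist_commute linorder_linear)
qed

definition proximal_orbit ::
    "'a::metric_space set \<Rightarrow> 'a set \<Rightarrow> ('a \<Rightarrow> 'a) \<Rightarrow> (nat \<Rightarrow> 'a) \<Rightarrow> bool" where
  "proximal_orbit A B T x \<longleftrightarrow>
    (\<forall>n. x n \<in> A) \<and> (\<forall>n. dist (x (Suc n)) (T (x n)) = setdist A B)"

lemma proximal_orbit_exists:
  assumes "T \<in> A \<rightarrow> B" and "T ` prox_left A B \<subseteq> prox_right A B" and "prox_left A B \<noteq> {}"
  obtains x where "proximal_orbit A B T x"
proof -
  obtain a where a: "a \<in> prox_left A B" using assms(3) by blast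
  have next_point: "\<exists>u. u \<in> prox_left A B \<and> dist u (T v) = setdist A B"
    if "v \<in> prox_left A B" for v
    using that assms(2) by (force simp: prox_left_def prox_right_def)
  have "\<exists>x. \<forall>n. x n \<in> prox_left A B \<and> dist (x (Suc n)) (T (x n)) = setdist A B"
    by (rule dependent_nat_choice) (use a next_point in blast)+
  then show thesis
    using that unfolding proximal_orbit_def prox_left_def by blast
qed

text \<open>
  If \<open>T (x n) = T (x (n + 2))\<close>, then \<open>x (n + 1)\<close> and \<open>x (n + 2)\<close> are each a proximal step of the
  other, so Condition \<open>\<Lambda>\<close> identifies them, and \<open>x (n + 1)\<close> is a best proximity point.
\<close>

lemma proximal_orbit_images_distinct:
  assumes orbit: "proximal_orbit A B T x" and "condition_Lambda A B T"
    and none: "\<And>z. \<not> best_proximity_point A B T z"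
  shows "T (x n) \<noteq> T (x (Suc n))" and "T (x n) \<noteq> T (x (Suc (Suc n)))"
proof -
  have xA: "x k \<in> A" and step: "dist (x (Suc k)) (T (x k)) = setdist A B" for k
    using orbit by (auto simp: proximal_orbit_def)
  show neighbours: "T (x n) \<noteq> T (x (Suc n))"
    using none[of "x (Suc n)"] xA step[of n] by (auto simp: best_proximity_point_def)
  show "T (x n) \<noteq> T (x (Suc (Suc n)))"
  proof
    assume "T (x n) = T (x (Suc (Suc n)))"
    then have "dist (x (Suc n)) (T (x (Suc (Suc n)))) = setdist A B"
      using step[of n] by simp
    then have "x (Suc n) = x (Suc (Suc n))"
      using assms(2) xA step[of "Suc n"] unfolding condition_Lambda_def by blast
    then show False
      using none[of "x (Suc n)"] xA step[of "Suc n"] by (auto simp: best_proximity_point_def)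
  qed
qed

lemma proximal_orbit_images_Cauchy:
  assumes orbit: "proximal_orbit A B T x"
    and "perimetric_proximal_contraction_2 A B T" and "condition_Lambda A B T"
    and none: "\<And>z. \<not> best_proximity_point A B T z"
  shows "Cauchy (\<lambda>n. T (x n))"
proof -
  have xA: "x n \<in> A" and step: "dist (x (Suc n)) (T (x n)) = setdist A B" for n
    using orbit by (auto simp: proximal_orbit_def)
  note distinct = proximal_orbit_images_distinct[OF orbit assms(3) none]
  obtain \<alpha> :: real where \<alpha>: "0 \<le> \<alpha>" "\<alpha> < 1"
    and contr: "\<forall>u1\<in>A. \<forall>u2\<in>A. \<forall>u3\<in>A. \<forall>x1\<in>A. \<forall>x2\<in>A. \<forall>x3\<in>A.
        T x1 \<noteq> T x2 \<longrightarrow> T x2 \<noteq> T x3 \<longrightarrow> T x3 \<noteq> T x1 \<longrightarrow>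
        dist u1 (T x1) = setdist A B \<longrightarrow>
        dist u2 (T x2) = setdist A B \<longrightarrow>
        dist u3 (T x3) = setdist A B \<longrightarrow>
        dist (T u1) (T u2) + dist (T u2) (T u3) + dist (T u3) (T u1)
          \<le> \<alpha> * (dist (T x1) (T x2) + dist (T x2) (T x3) + dist (T x3) (T x1))"
    using assms(2) unfolding perimetric_proximal_contraction_2_def
    by (elim exE conjE) (rule that)
  define p where "p n = dist (T (x n)) (T (x (Suc n)))
      + dist (T (x (Suc n))) (T (x (Suc (Suc n))))
      + dist (T (x (Suc (Suc n)))) (T (x n))" for n
  have p_Suc: "p (Suc n) \<le> \<alpha> * p n" for n
    unfolding p_def using distinct[of n] distinct(1)[of "Suc n"]
    by (intro contr[rule_format] xA step) auto
  have p_le: "p n \<le> p 0 * \<alpha> ^ n" for n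
  proof (induction n)
    case (Suc n)
    have "p (Suc n) \<le> \<alpha> * (p 0 * \<alpha> ^ n)"
      using p_Suc[of n] mult_left_mono[OF Suc \<alpha>(1)] by linarith
    then show ?case by (simp add: mult_ac)
  qed simp
  have "dist (T (x n)) (T (x (Suc n))) \<le> p 0 * \<alpha> ^ n" for n
    using p_le[of n] zero_le_dist[of "T (x (Suc n))" "T (x (Suc (Suc n)))"]
      zero_le_dist[of "T (x (Suc (Suc n)))" "T (x n)"] unfolding p_def[of n] by linarith
  then show ?thesis by (rule Cauchy_if_geometric_steps[OF \<alpha>])
qed

text \<open>
  The distances from \<open>y\<close> to the orbit tend to \<open>d(y, A)\<close> because \<open>x (n + 1)\<close> is within \<open>d(A, B)\<close> of
  \<open>T (x n)\<close>, which tends to \<open>y\<close>, while \<open>d(A, B) \<le> d(y, A)\<close>; this is the situation in which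
  approximative compactness applies.
\<close>

lemma proximal_orbit_limit:
  assumes orbit: "proximal_orbit A B T x" and "closed A" and "continuous_on A T"
    and "approximatively_compact_wrt A B" and "y \<in> B"
    and lim: "(\<lambda>n. T (x n)) \<longlonglongrightarrow> y"
  shows "\<exists>z. best_proximity_point A B T z"
proof -
  have xA: "x n \<in> A" and step: "dist (x (Suc n)) (T (x n)) = setdist A B" for n
    using orbit by (auto simp: proximal_orbit_def)
  have gap: "setdist A B \<le> infdist y A"
    using setdist_le_sing[OF \<open>y \<in> B\<close>, of A] by (simp add: infdist_eq_setdist setdist_sym)
  have upper: "dist y (x (Suc n)) \<le> dist (T (x n)) y + infdist y A" for n
    using dist_triangle[of y "x (Suc n)" "T (x n)"] step[of n] gap by (simp add: dist_commute)
  have "(\<lambda>n. dist y (x (Suc n))) \<longlonglongrightarrow> infdist y A"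
  proof (rule tendsto_sandwich)
    show "\<forall>\<^sub>F n in sequentially. infdist y A \<le> dist y (x (Suc n))"
      using xA by (intro always_eventually allI infdist_le)
    show "\<forall>\<^sub>F n in sequentially. dist y (x (Suc n)) \<le> dist (T (x n)) y + infdist y A"
      using upper by simp
    show "(\<lambda>n. dist (T (x n)) y + infdist y A) \<longlonglongrightarrow> infdist y A"
      using tendsto_add[OF tendsto_dist[OF lim tendsto_const[of y]] tendsto_const[of "infdist y A"]]
      by simp
  qed (rule tendsto_const)
  then have "\<exists>r. strict_mono r \<and> convergent ((\<lambda>n. x (Suc n)) \<circ> r)"
    using assms(4)[unfolded approximatively_compact_wrt_def, rule_format,
        of "\<lambda>n. x (Suc n)"] xA \<open>y \<in> B\<close> by simp blast
  then obtain r z where r: "strict_mono r" and z: "(\<lambda>k. x (Suc (r k))) \<longlonglongrightarrow> z"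
    unfolding convergent_def by (auto simp: comp_def)
  have zA: "z \<in> A"
    using closed_sequentially[OF \<open>closed A\<close> _ z] xA by blast
  have Ty: "(\<lambda>k. T (x (r k))) \<longlonglongrightarrow> y"
    using LIMSEQ_subseq_LIMSEQ[OF lim r] by (simp add: comp_def)
  have "(\<lambda>k. T (x (Suc (r k)))) \<longlonglongrightarrow> T z"
    using continuous_on_tendsto_compose[OF assms(3) z zA] xA by simp
  moreover have "(\<lambda>k. T (x (Suc (r k)))) \<longlonglongrightarrow> y"
    using LIMSEQ_subseq_LIMSEQ[OF LIMSEQ_Suc[OF lim] r] by (simp add: comp_def)
  ultimately have "T z = y" by (rule LIMSEQ_unique)
  moreover have "dist z y = setdist A B"
    using tendsto_dist[OF z Ty] by (simp add: step LIMSEQ_const_iff)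
  ultimately show ?thesis using zA unfolding best_proximity_point_def by blast
qed

lemma no_three_best_proximity_points:
  assumes "perimetric_proximal_contraction_2 A B T" and "inj_on T A"
    and "best_proximity_point A B T a" "best_proximity_point A B T b"
        "best_proximity_point A B T c"
    and "a \<noteq> b" "b \<noteq> c" "c \<noteq> a"
  shows False
proof -
  define P where "P = dist (T a) (T b) + dist (T b) (T c) + dist (T c) (T a)"
  have A: "a \<in> A" "b \<in> A" "c \<in> A" and D: "dist a (T a) = setdist A B"
      "dist b (T b) = setdist A B" "dist c (T c) = setdist A B"
    using assms(3-5) by (auto simp: best_proximity_point_def)
  have ne: "T a \<noteq> T b" "T b \<noteq> T c" "T c \<noteq> T a"
    using assms(2,6-8) A by (auto dest: inj_onD)
  obtain \<alpha> :: real where "\<alpha> < 1" and "P \<le> \<alpha> * P"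
    using assms(1) A D ne unfolding perimetric_proximal_contraction_2_def P_def by blast
  moreover have "0 < P"
    unfolding P_def using ne by (simp add: add_pos_pos)
  ultimately show False
    using mult_strict_right_mono[of \<alpha> 1 P] by simp
qed

theorem theorem2p7:
  fixes A B :: "'a::complete_space set" and T :: "'a \<Rightarrow> 'a"
  assumes "A \<noteq> {}" and "B \<noteq> {}"
    and "closed A" and "closed B"
    and "infinite (prox_left A B) \<or> card (prox_left A B) \<ge> 3"
    and "approximatively_compact_wrt A B"
    and "T \<in> A \<rightarrow> B"
    and "continuous_on A T"
    and "perimetric_proximal_contraction_2 A B T"
    and "T ` prox_left A B \<subseteq> prox_right A B"
    and "condition_Lambda A B T"
  shows "(\<exists>x. best_proximity_point A B T x) \<and>
    (inj_on T A \<longrightarrow>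
      finite {x. best_proximity_point A B T x} \<and>
      card {x. best_proximity_point A B T x} \<le> 2)"
proof (intro conjI impI)
  show "\<exists>x. best_proximity_point A B T x"
  proof (rule ccontr)
    assume none: "\<not> ?thesis"
    have "prox_left A B \<noteq> {}" using assms(5) by auto
    then obtain x where x: "proximal_orbit A B T x"
      using proximal_orbit_exists assms(7,10) by metis
    have "Cauchy (\<lambda>n. T (x n))"
      using proximal_orbit_images_Cauchy[OF x assms(9,11)] none by blast
    then obtain y where y: "(\<lambda>n. T (x n)) \<longlonglongrightarrow> y"
      by (meson Cauchy_convergent convergentD)
    moreover have "y \<in> B"
      using closed_sequentially[OF assms(4) _ y] x assms(7)
      by (auto simp: proximal_orbit_def)
    ultimately show False
      using proximal_orbit_limit[OF x assms(3,8,6)] none by blast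
  qed
next
  let ?S = "{x. best_proximity_point A B T x}"
  assume inj: "inj_on T A"
  have no_triple: "card S \<noteq> 3" if "S \<subseteq> ?S" for S
  proof
    assume "card S = 3"
    then obtain a b c where "S = {a, b, c}" "a \<noteq> b" "b \<noteq> c" "a \<noteq> c"
      unfolding card_3_iff by blast
    then show False
      using no_three_best_proximity_points[OF assms(9) inj, of a b c] that by auto
  qed
  have "finite ?S"
    using infinite_arbitrarily_large[of ?S 3] no_triple by blast
  moreover have "\<not> 3 \<le> card ?S"
    using obtain_subset_with_card_n[of 3 ?S] no_triple by metis
  ultimately show "finite ?S" "card ?S \<le> 2" by simp_all
qed

end
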